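(* Let $D$ be a finite generalized digroup, fix a bar-unit $\xi\in\mathrm{Halo}(D)$, and identify $D\simeq G\times E$ with $G=G_l^{\xi}$ and $E=\mathrm{Halo}(D)$ by the structure isomorphism recalled in the context. Then the number of orbits of $\mathrm{Inn}(\mathrm{Conj}(D))$ on $\mathrm{Conj}(D)$ is $$\#\bigl((G\times E)/\mathrm{Inn}(\mathrm{Conj}(D))\bigr)=\frac1{|G|}\sum_{g\in G}|C_G(g)|\,|\mathrm{Fix}_E(g)|,$$ where $C_G(g)=\{h\in G\mid gh=hg\}$ and $\mathrm{Fix}_E(g)=\{\beta\in E\mid g\bullet\beta=\beta\}$.
   Context: A generalized digroup is a nonempty set $D$ with two associative binary operations $\vdash,\dashv$ satisfying $x\vdash(y\dashv z)=(x\vdash y)\dashv z$, $x\dashv(y\dashv z)=x\dashv(y\vdash z)$, $(x\vdash y)\vdash z=(x\dashv y)\vdash z$, such that there is at least one bar-unit (an element $\xi$ with $x\dashv\xi=x=\xi\vdash x$ for all $x\in D$), and for every bar-unit $\xi$ and every $x\in D$ there are $x^{-1}_{r,\xi},x^{-1}_{l,\xi}\in D$ with $x\vdash x^{-1}_{r,\xi}=\xi$ and $x^{-1}_{l,\xi}\dashv x=\xi$. $\mathrm{Halo}(D)$ is the set of bar-units. Structure isomorphism (known): fix a bar-unit $\xi$. Let $G:=G_l^\xi=\{\xi\dashv x\mid x\in D\}$, the left group associated with $\xi$; it is a group under $\dashv$ with identity $\xi$ (law written multiplicatively). Let $E:=\mathrm{Halo}(D)$, a left $G$-set via $g\bullet\alpha:=g\vdash\alpha\dashv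 g^{-1}$ ($g^{-1}$ the inverse in $G$). Then $G\times E$ with $(g,\alpha)\vdash(h,\beta)=(gh,g\bullet\beta)$ and $(g,\alpha)\dashv(h,\beta)=(gh,\alpha)$ is a generalized digroup, and $x\mapsto(\xi\dashv x,\ x\dashv x^{-1}_{l,\xi})$ is an isomorphism $D\to G\times E$, used to identify them. The conjugation rack $\mathrm{Conj}(D)$ is the set $D$ with $x\triangleright y:=(x\vdash y)\dashv x^{-1}$, where $x^{-1}$ is any one-sided inverse of $x$ (right for $\vdash$ or left for $\dashv$) relative to a bar-unit; this is independent of the choice and is a rack, i.e. each left translation $L_x(y)=x\triangleright y$ is bijective and $x\triangleright(y\triangleright z)=(x\triangleright y)\triangleright(x\triangleright z)$. For a rack $X$, $\mathrm{Inn}(X)$ is the subgroup of $\mathrm{Sym}(X)$ generated by all left translations $L_x$. *)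

theory Defs
  imports Complex_Main "HOL-Algebra.Group_Action" "HOL-Algebra.Elementary_Groups"
begin

section \<open>Generalized digroups\<close>

record 'a digroup = "'a partial_object" +
  rprod :: "['a, 'a] \<Rightarrow> 'a" (infixl \<open>\<turnstile>\<index>\<close> 70)
  lprod :: "['a, 'a] \<Rightarrow> 'a" (infixl \<open>\<stileturn>\<index>\<close> 70)

definition Halo :: "('a, 'b) digroup_scheme \<Rightarrow> 'a set" where
  "Halo D = {\<xi> \<in> carrier D. \<forall>x \<in> carrier D. x \<stileturn>\<^bsub>D\<^esub> \<xi> = x \<and> \<xi> \<turnstile>\<^bsub>D\<^esub> x = x}"

locale generalized_digroup =
  fixes D (structure)
  assumes rprod_closed: "\<lbrakk>x \<in> carrier D; y \<in> carrier D\<rbrakk> \<Longrightarrow> x \<turnstile> y \<in> carrier D"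
    and lprod_closed: "\<lbrakk>x \<in> carrier D; y \<in> carrier D\<rbrakk> \<Longrightarrow> x \<stileturn> y \<in> carrier D"
    and rprod_assoc: "\<lbrakk>x \<in> carrier D; y \<in> carrier D; z \<in> carrier D\<rbrakk>
          \<Longrightarrow> (x \<turnstile> y) \<turnstile> z = x \<turnstile> (y \<turnstile> z)"
    and lprod_assoc: "\<lbrakk>x \<in> carrier D; y \<in> carrier D; z \<in> carrier D\<rbrakk>
          \<Longrightarrow> (x \<stileturn> y) \<stileturn> z = x \<stileturn> (y \<stileturn> z)"
    and inner_assoc: "\<lbrakk>x \<in> carrier D; y \<in> carrier D; z \<in> carrier D\<rbrakk>
          \<Longrightarrow> x \<turnstile> (y \<stileturn> z) = (x \<turnstile> y) \<stileturn> z"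
    and lprod_bar: "\<lbrakk>x \<in> carrier D; y \<in> carrier D; z \<in> carrier D\<rbrakk>
          \<Longrightarrow> x \<stileturn> (y \<stileturn> z) = x \<stileturn> (y \<turnstile> z)"
    and rprod_bar: "\<lbrakk>x \<in> carrier D; y \<in> carrier D; z \<in> carrier D\<rbrakk>
          \<Longrightarrow> (x \<turnstile> y) \<turnstile> z = (x \<stileturn> y) \<turnstile> z"
    and bar_unit_exists: "Halo D \<noteq> {}"
    and right_inverse_exists: "\<lbrakk>\<xi> \<in> Halo D; x \<in> carrier D\<rbrakk>
          \<Longrightarrow> \<exists>y \<in> carrier D. x \<turnstile> y = \<xi>"
    and left_inverse_exists: "\<lbrakk>\<xi> \<in> Halo D; x \<in> carrier D\<rbrakk>
          \<Longrightarrow> \<exists>y \<in> carrier D. y \<stileturn> x = \<xi>"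


section \<open>The structure isomorphism\<close>

definition left_group :: "('a, 'b) digroup_scheme \<Rightarrow> 'a \<Rightarrow> 'a monoid" where
  "left_group D \<xi> = \<lparr>carrier = {\<xi> \<stileturn>\<^bsub>D\<^esub> x | x. x \<in> carrier D}, mult = (\<stileturn>\<^bsub>D\<^esub>), one = \<xi>\<rparr>"

definition halo_action :: "('a, 'b) digroup_scheme \<Rightarrow> 'a \<Rightarrow> 'a \<Rightarrow> 'a \<Rightarrow> 'a" where
  "halo_action D \<xi> g \<alpha> = (g \<turnstile>\<^bsub>D\<^esub> \<alpha>) \<stileturn>\<^bsub>D\<^esub> inv\<^bsub>left_group D \<xi>\<^esub> g"

text \<open>The left inverse relative to a fixed bar-unit is unique; see \<open>left_inverse_unique\<close> below.\<close>

definition left_inverse :: "('a, 'b) digroup_scheme \<Rightarrow> 'a \<Rightarrow> 'a \<Rightarrow> 'a" where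
  "left_inverse D \<xi> x = (THE y. y \<in> carrier D \<and> y \<stileturn>\<^bsub>D\<^esub> x = \<xi>)"

definition structure_iso :: "('a, 'b) digroup_scheme \<Rightarrow> 'a \<Rightarrow> 'a \<Rightarrow> 'a \<times> 'a" where
  "structure_iso D \<xi> x = (\<xi> \<stileturn>\<^bsub>D\<^esub> x, x \<stileturn>\<^bsub>D\<^esub> left_inverse D \<xi> x)"


section \<open>Racks and the conjugation rack\<close>

record 'a rack_struct = "'a partial_object" +
  rack_op :: "['a, 'a] \<Rightarrow> 'a" (infixl \<open>\<triangleright>\<index>\<close> 70)

text \<open>Elements of \<^const>\<open>BijGroup\<close> are extensional, hence the restriction of the left translations.\<close>

definition left_translation :: "('a, 'b) rack_struct_scheme \<Rightarrow> 'a \<Rightarrow> 'a \<Rightarrow> 'a" where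
  "left_translation X x = (\<lambda>y \<in> carrier X. x \<triangleright>\<^bsub>X\<^esub> y)"

locale rack =
  fixes X (structure)
  assumes left_translation_bij: "x \<in> carrier X \<Longrightarrow> left_translation X x \<in> Bij (carrier X)"
    and self_distrib: "\<lbrakk>x \<in> carrier X; y \<in> carrier X; z \<in> carrier X\<rbrakk>
          \<Longrightarrow> x \<triangleright> (y \<triangleright> z) = (x \<triangleright> y) \<triangleright> (x \<triangleright> z)"

definition Inn :: "('a, 'b) rack_struct_scheme \<Rightarrow> ('a \<Rightarrow> 'a) monoid" where
  "Inn X = subgroup_generated (BijGroup (carrier X)) (left_translation X ` carrier X)"

definition one_sided_inverses :: "('a, 'b) digroup_scheme \<Rightarrow> 'a \<Rightarrow> 'a set" where
  "one_sided_inverses D x =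
     {y \<in> carrier D. \<exists>\<xi> \<in> Halo D. x \<turnstile>\<^bsub>D\<^esub> y = \<xi> \<or> y \<stileturn>\<^bsub>D\<^esub> x = \<xi>}"

text \<open>The choice of the one-sided inverse is immaterial; see \<open>conj_rack_op_eq\<close> below.\<close>

definition Conj :: "('a, 'b) digroup_scheme \<Rightarrow> 'a rack_struct" where
  "Conj D = \<lparr>carrier = carrier D,
     rack_op = (\<lambda>x y. (x \<turnstile>\<^bsub>D\<^esub> y) \<stileturn>\<^bsub>D\<^esub> (SOME z. z \<in> one_sided_inverses D x))\<rparr>"


text \<open>\<^term>\<open>Inn (Conj D)\<close> acts on \<open>G \<times> E\<close> through the identification of \<open>D\<close> with \<open>G \<times> E\<close>.\<close>

definition transported_action :: "('a, 'b) digroup_scheme \<Rightarrow> 'a \<Rightarrow> ('a \<Rightarrow> 'a) \<Rightarrow> 'a \<times> 'a \<Rightarrow> 'a \<times> 'a" where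
  "transported_action D \<xi> f p =
     structure_iso D \<xi> (f (inv_into (carrier D) (structure_iso D \<xi>) p))"

definition elem_centralizer :: "('a, 'b) monoid_scheme \<Rightarrow> 'a \<Rightarrow> 'a set" where
  "elem_centralizer G g = {h \<in> carrier G. g \<otimes>\<^bsub>G\<^esub> h = h \<otimes>\<^bsub>G\<^esub> g}"


section \<open>Well-definedness\<close>

context generalized_digroup
begin

lemma HaloD:
  assumes "\<xi> \<in> Halo D"
  shows "\<xi> \<in> carrier D" "x \<in> carrier D \<Longrightarrow> x \<stileturn> \<xi> = x" "x \<in> carrier D \<Longrightarrow> \<xi> \<turnstile> x = x"
  using assms by (auto simp: Halo_def)

lemma lprod_halo_mid:
  assumes "\<xi> \<in> Halo D" "x \<in> carrier D" "y \<in> carrier D"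
  shows "x \<stileturn> (\<xi> \<stileturn> y) = x \<stileturn> y"
  using assms HaloD[OF assms(1)] lprod_assoc[of x \<xi> y] by simp

lemma left_group_mult:
  assumes "\<xi> \<in> Halo D" "x \<in> carrier D" "y \<in> carrier D"
  shows "(\<xi> \<stileturn> x) \<stileturn> (\<xi> \<stileturn> y) = \<xi> \<stileturn> (x \<stileturn> y)"
  using assms HaloD[OF assms(1)] by (simp add: lprod_assoc lprod_closed lprod_halo_mid)

lemma group_left_group:
  assumes "\<xi> \<in> Halo D"
  shows "group (left_group D \<xi>)"
proof (rule groupI)
  note H = HaloD[OF assms]
  show "\<one>\<^bsub>left_group D \<xi>\<^esub> \<in> carrier (left_group D \<xi>)"
    using H(1) H(2)[OF H(1)] by (force simp: left_group_def)
  show "x \<otimes>\<^bsub>left_group D \<xi>\<^esub> y \<in> carrier (left_group D \<xi>)"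
    if "x \<in> carrier (left_group D \<xi>)" "y \<in> carrier (left_group D \<xi>)" for x y
    using that left_group_mult[OF assms] lprod_closed by (force simp: left_group_def)
  show "(x \<otimes>\<^bsub>left_group D \<xi>\<^esub> y) \<otimes>\<^bsub>left_group D \<xi>\<^esub> z
      = x \<otimes>\<^bsub>left_group D \<xi>\<^esub> (y \<otimes>\<^bsub>left_group D \<xi>\<^esub> z)"
    if "x \<in> carrier (left_group D \<xi>)" "y \<in> carrier (left_group D \<xi>)"
      "z \<in> carrier (left_group D \<xi>)" for x y z
    using that H(1) lprod_closed lprod_assoc by (auto simp: left_group_def)
  show "\<one>\<^bsub>left_group D \<xi>\<^esub> \<otimes>\<^bsub>left_group D \<xi>\<^esub> x = x"
    if "x \<in> carrier (left_group D \<xi>)" for x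
    using that H lprod_halo_mid[OF assms] by (auto simp: left_group_def)
  show "\<exists>y \<in> carrier (left_group D \<xi>). y \<otimes>\<^bsub>left_group D \<xi>\<^esub> x = \<one>\<^bsub>left_group D \<xi>\<^esub>"
    if x: "x \<in> carrier (left_group D \<xi>)" for x
  proof -
    obtain a where a: "a \<in> carrier D" "x = \<xi> \<stileturn> a"
      using x by (auto simp: left_group_def)
    obtain b where b: "b \<in> carrier D" "b \<stileturn> a = \<xi>"
      using left_inverse_exists[OF assms a(1)] by blast
    have "(\<xi> \<stileturn> b) \<stileturn> x = \<xi>"
      using a b H left_group_mult[OF assms b(1) a(1)] by simp
    then show ?thesis
      using b by (auto simp: left_group_def)
  qed
qed

lemma left_group_inv:
  assumes "\<xi> \<in> Halo D" "x \<in> carrier D"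
  defines "w \<equiv> inv\<^bsub>left_group D \<xi>\<^esub> (\<xi> \<stileturn> x)"
  shows "w \<in> carrier D" "\<xi> \<stileturn> w = w" "w \<stileturn> x = \<xi>" "(\<xi> \<stileturn> x) \<stileturn> w = \<xi>"
proof -
  interpret G: group "left_group D \<xi>" by (rule group_left_group[OF assms(1)])
  note H = HaloD[OF assms(1)]
  have x: "\<xi> \<stileturn> x \<in> carrier (left_group D \<xi>)"
    using assms by (auto simp: left_group_def)
  have w: "w \<in> carrier (left_group D \<xi>)"
    unfolding w_def by (rule G.inv_closed[OF x])
  show c: "w \<in> carrier D" using w H lprod_closed by (auto simp: left_group_def)
  show "\<xi> \<stileturn> w = w" using G.l_one[OF w] by (simp add: left_group_def)
  show "(\<xi> \<stileturn> x) \<stileturn> w = \<xi>"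
    using G.r_inv[OF x] unfolding w_def[symmetric] by (simp add: left_group_def)
  have "w \<stileturn> (\<xi> \<stileturn> x) = \<xi>"
    using G.l_inv[OF x] unfolding w_def[symmetric] by (simp add: left_group_def)
  then show "w \<stileturn> x = \<xi>" using lprod_halo_mid[OF assms(1) c assms(2)] by simp
qed

lemma left_inverse_unique:
  assumes "\<xi> \<in> Halo D" "x \<in> carrier D"
  shows "\<exists>!y. y \<in> carrier D \<and> y \<stileturn> x = \<xi>"
    and "left_inverse D \<xi> x = inv\<^bsub>left_group D \<xi>\<^esub> (\<xi> \<stileturn> x)"
proof -
  define w where "w = inv\<^bsub>left_group D \<xi>\<^esub> (\<xi> \<stileturn> x)"
  note w = left_group_inv[OF assms, folded w_def]
  note H = HaloD[OF assms(1)]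
  have u: "y = w" if y: "y \<in> carrier D" "y \<stileturn> x = \<xi>" for y
  proof -
    have "w = (y \<stileturn> (\<xi> \<stileturn> x)) \<stileturn> w"
      using y w assms lprod_halo_mid[OF assms(1) y(1) assms(2)] by simp
    also have "\<dots> = y \<stileturn> ((\<xi> \<stileturn> x) \<stileturn> w)"
      using y w assms H lprod_closed by (simp add: lprod_assoc)
    also have "\<dots> = y" using y w H by simp
    finally show ?thesis by simp
  qed
  show 1: "\<exists>!y. y \<in> carrier D \<and> y \<stileturn> x = \<xi>" using u w by blast
  show "left_inverse D \<xi> x = inv\<^bsub>left_group D \<xi>\<^esub> (\<xi> \<stileturn> x)"
    unfolding left_inverse_def w_def[symmetric] by (rule the_equality) (use u w in blast)+
qed

lemma lprod_one_sided_inverse: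
  assumes "\<xi> \<in> Halo D" "x \<in> carrier D" "a \<in> carrier D" "z \<in> one_sided_inverses D x"
  shows "a \<stileturn> z = a \<stileturn> inv\<^bsub>left_group D \<xi>\<^esub> (\<xi> \<stileturn> x)"
proof -
  interpret G: group "left_group D \<xi>" by (rule group_left_group[OF assms(1)])
  note H = HaloD[OF assms(1)]
  have z: "z \<in> carrier D" using assms by (auto simp: one_sided_inverses_def)
  obtain \<zeta> where \<zeta>: "\<zeta> \<in> Halo D" "x \<turnstile> z = \<zeta> \<or> z \<stileturn> x = \<zeta>"
    using assms by (auto simp: one_sided_inverses_def)
  have mem: "\<xi> \<stileturn> x \<in> carrier (left_group D \<xi>)" "\<xi> \<stileturn> z \<in> carrier (left_group D \<xi>)"
    using assms z by (auto simp: left_group_def)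
  have "\<xi> \<stileturn> (x \<stileturn> z) = \<xi> \<or> \<xi> \<stileturn> (z \<stileturn> x) = \<xi>"
    using \<zeta> HaloD(2)[OF \<zeta>(1) H(1)] lprod_bar[OF H(1) assms(2) z] by auto
  then have "(\<xi> \<stileturn> x) \<stileturn> (\<xi> \<stileturn> z) = \<xi> \<or> (\<xi> \<stileturn> z) \<stileturn> (\<xi> \<stileturn> x) = \<xi>"
    using left_group_mult[OF assms(1)] assms z by simp
  then have "inv\<^bsub>left_group D \<xi>\<^esub> (\<xi> \<stileturn> x) = \<xi> \<stileturn> z"
    using G.inv_equality[of "\<xi> \<stileturn> z" "\<xi> \<stileturn> x"] G.inv_equality[of "\<xi> \<stileturn> x" "\<xi> \<stileturn> z"] mem
      G.inv_inv[of "\<xi> \<stileturn> z"]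
    by (auto simp: left_group_def)
  then show ?thesis using lprod_halo_mid[OF assms(1) assms(3) z] by simp
qed

lemma one_sided_inverses_nonempty:
  assumes "x \<in> carrier D"
  shows "one_sided_inverses D x \<noteq> {}"
  using bar_unit_exists right_inverse_exists assms unfolding one_sided_inverses_def by blast

lemma conj_rack_op_eq:
  assumes "x \<in> carrier D" "y \<in> carrier D" "z \<in> one_sided_inverses D x"
  shows "x \<triangleright>\<^bsub>Conj D\<^esub> y = (x \<turnstile> y) \<stileturn> z"
proof -
  obtain \<xi> where \<xi>: "\<xi> \<in> Halo D" using bar_unit_exists by blast
  have "(SOME z. z \<in> one_sided_inverses D x) \<in> one_sided_inverses D x"
    using assms(3) by (rule someI)
  then show ?thesis
    using lprod_one_sided_inverse[OF \<xi> assms(1) rprod_closed[OF assms(1,2)]] assms(3)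
    by (simp add: Conj_def)
qed

lemma conj_rack_op_left_group:
  assumes "\<xi> \<in> Halo D" "x \<in> carrier D" "y \<in> carrier D"
  shows "x \<triangleright>\<^bsub>Conj D\<^esub> y = halo_action D \<xi> (\<xi> \<stileturn> x) y"
proof -
  note H = HaloD[OF assms(1)]
  obtain z where z: "z \<in> one_sided_inverses D x"
    using one_sided_inverses_nonempty[OF assms(2)] by blast
  have "(\<xi> \<stileturn> x) \<turnstile> y = x \<turnstile> y" using rprod_bar[OF H(1) assms(2,3)] H assms by simp
  then show ?thesis
    using conj_rack_op_eq[OF assms(2,3) z]
      lprod_one_sided_inverse[OF assms(1,2) rprod_closed[OF assms(2,3)] z]
    by (simp add: halo_action_def)
qed

lemma bij_betw_structure_iso:
  assumes "\<xi> \<in> Halo D"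
  shows "bij_betw (structure_iso D \<xi>) (carrier D) (carrier (left_group D \<xi>) \<times> Halo D)"
proof (rule bij_betw_byWitness[where f' = "\<lambda>(g, \<alpha>). \<alpha> \<stileturn> g"])
  note H = HaloD[OF assms]
  interpret G: group "left_group D \<xi>" by (rule group_left_group[OF assms])
  have Gc: "g \<in> carrier D" "\<xi> \<stileturn> g = g" if "g \<in> carrier (left_group D \<xi>)" for g
    using that H lprod_closed lprod_halo_mid[OF assms] by (auto simp: left_group_def)
  show "\<forall>x \<in> carrier D. (case structure_iso D \<xi> x of (g, \<alpha>) \<Rightarrow> \<alpha> \<stileturn> g) = x"
  proof
    fix x assume x: "x \<in> carrier D"
    note w = left_group_inv[OF assms x, folded left_inverse_unique(2)[OF assms x]]
    show "(case structure_iso D \<xi> x of (g, \<alpha>) \<Rightarrow> \<alpha> \<stileturn> g) = x"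
      using x w H lprod_closed by (simp add: structure_iso_def lprod_assoc lprod_halo_mid assms)
  qed
  show "\<forall>p \<in> carrier (left_group D \<xi>) \<times> Halo D.
          structure_iso D \<xi> (case p of (g, \<alpha>) \<Rightarrow> \<alpha> \<stileturn> g) = p"
  proof clarify
    fix g \<alpha> assume g: "g \<in> carrier (left_group D \<xi>)" and \<alpha>: "\<alpha> \<in> Halo D"
    note A = HaloD[OF \<alpha>]
    have 1: "\<xi> \<stileturn> (\<alpha> \<stileturn> g) = g"
      using lprod_halo_mid[OF \<alpha> H(1) Gc(1)[OF g]] Gc(2)[OF g] by simp
    have w: "left_inverse D \<xi> (\<alpha> \<stileturn> g) = inv\<^bsub>left_group D \<xi>\<^esub> g"
      using left_inverse_unique(2)[OF assms lprod_closed[OF A(1) Gc(1)[OF g]]] 1 by simp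
    have "(\<alpha> \<stileturn> g) \<stileturn> inv\<^bsub>left_group D \<xi>\<^esub> g = \<alpha> \<stileturn> (g \<stileturn> inv\<^bsub>left_group D \<xi>\<^esub> g)"
      using lprod_assoc A Gc(1)[OF g] Gc(1)[OF G.inv_closed[OF g]] by simp
    also have "\<dots> = \<alpha>"
      using G.r_inv[OF g] H(2)[OF A(1)] by (simp add: left_group_def)
    finally show "structure_iso D \<xi> (\<alpha> \<stileturn> g) = (g, \<alpha>)"
      using 1 w by (simp add: structure_iso_def)
  qed
  show "(\<lambda>(g, \<alpha>). \<alpha> \<stileturn> g) ` (carrier (left_group D \<xi>) \<times> Halo D) \<subseteq> carrier D"
    using Gc(1) HaloD(1) lprod_closed by auto
  show "structure_iso D \<xi> ` carrier D \<subseteq> carrier (left_group D \<xi>) \<times> Halo D"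
  proof clarify
    fix x g \<alpha> assume x: "x \<in> carrier D" and e: "(g, \<alpha>) = structure_iso D \<xi> x"
    define w where "w = left_inverse D \<xi> x"
    note w = left_group_inv[OF assms x, folded left_inverse_unique(2)[OF assms x] w_def]
    obtain y where y: "y \<in> carrier D" "x \<turnstile> y = \<xi>" using right_inverse_exists[OF assms x] by blast
    have wy: "w \<turnstile> b = y \<turnstile> b" if b: "b \<in> carrier D" for b
    proof -
      have "w \<turnstile> b = w \<turnstile> ((x \<turnstile> y) \<turnstile> b)"
        unfolding y(2) using b H by simp
      also have "\<dots> = (w \<turnstile> x) \<turnstile> (y \<turnstile> b)"
        using rprod_assoc[OF x y(1) b] rprod_assoc[OF w(1) x rprod_closed[OF y(1) b]] by simp
      also have "\<dots> = (w \<stileturn> x) \<turnstile> (y \<turnstile> b)"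
        by (rule rprod_bar[OF w(1) x rprod_closed[OF y(1) b]])
      finally show ?thesis using w b y H by (simp add: rprod_closed)
    qed
    have "x \<stileturn> w \<in> Halo D"
      unfolding Halo_def
    proof (intro CollectI conjI ballI)
      fix a assume a: "a \<in> carrier D"
      have "a \<stileturn> (x \<stileturn> w) = a \<stileturn> ((\<xi> \<stileturn> x) \<stileturn> w)"
        using lprod_halo_mid[OF assms a lprod_closed[OF x w(1)]] lprod_assoc[OF H(1) x w(1)] by simp
      then show "a \<stileturn> (x \<stileturn> w) = a" using w H a by simp
      have "(x \<stileturn> w) \<turnstile> a = x \<turnstile> (w \<turnstile> a)"
        using rprod_bar[OF x w(1) a] rprod_assoc[OF x w(1) a] by simp
      also have "\<dots> = a" using wy[OF a] rprod_assoc[OF x y(1) a] y H a by simp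
      finally show "(x \<stileturn> w) \<turnstile> a = a" .
    qed (use x w lprod_closed in auto)
    then show "g \<in> carrier (left_group D \<xi>) \<and> \<alpha> \<in> Halo D"
      using e x by (auto simp: structure_iso_def w_def left_group_def)
  qed
qed

lemma halo_action_mult:
  assumes "\<xi> \<in> Halo D" "g \<in> carrier (left_group D \<xi>)" "h \<in> carrier (left_group D \<xi>)" "y \<in> carrier D"
  shows "halo_action D \<xi> g (halo_action D \<xi> h y) = halo_action D \<xi> (g \<stileturn> h) y"
proof -
  note H = HaloD[OF assms(1)]
  interpret G: group "left_group D \<xi>" by (rule group_left_group[OF assms(1)])
  have Gc: "g \<in> carrier D" if "g \<in> carrier (left_group D \<xi>)" for g
    using that H lprod_closed by (auto simp: left_group_def)
  define g' h' where "g' = inv\<^bsub>left_group D \<xi>\<^esub> g" and "h' = inv\<^bsub>left_group D \<xi>\<^esub> h"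
  have c: "g \<in> carrier D" "h \<in> carrier D" "g' \<in> carrier D" "h' \<in> carrier D"
    unfolding g'_def h'_def using assms Gc G.inv_closed by auto
  have i: "inv\<^bsub>left_group D \<xi>\<^esub> (g \<stileturn> h) = h' \<stileturn> g'"
    using G.inv_mult_group[OF assms(2,3)] by (simp add: left_group_def g'_def h'_def)
  have "(g \<turnstile> ((h \<turnstile> y) \<stileturn> h')) \<stileturn> g' = ((g \<turnstile> (h \<turnstile> y)) \<stileturn> h') \<stileturn> g'"
    using c assms(4) by (simp add: inner_assoc rprod_closed)
  also have "\<dots> = (g \<turnstile> (h \<turnstile> y)) \<stileturn> (h' \<stileturn> g')"
    using c assms(4) by (simp add: lprod_assoc rprod_closed)
  also have "g \<turnstile> (h \<turnstile> y) = (g \<stileturn> h) \<turnstile> y"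
    using c assms(4) by (simp add: rprod_assoc rprod_bar[symmetric])
  finally show ?thesis
    unfolding halo_action_def g'_def[symmetric] h'_def[symmetric] i .
qed

lemma rack_Conj: "rack (Conj D)"
proof -
  obtain \<xi> where \<xi>: "\<xi> \<in> Halo D" using bar_unit_exists by blast
  note H = HaloD[OF \<xi>]
  interpret G: group "left_group D \<xi>" by (rule group_left_group[OF \<xi>])
  let ?c = "halo_action D \<xi>"
  have Gc: "g \<in> carrier D" "\<xi> \<stileturn> g = g" if "g \<in> carrier (left_group D \<xi>)" for g
    using that H lprod_closed lprod_halo_mid[OF \<xi>] by (auto simp: left_group_def)
  have mem: "\<xi> \<stileturn> x \<in> carrier (left_group D \<xi>)" if "x \<in> carrier D" for x
    using that by (auto simp: left_group_def)
  have cc: "?c g y \<in> carrier D" if "g \<in> carrier (left_group D \<xi>)" "y \<in> carrier D" for g y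
    using that Gc(1) G.inv_closed by (auto simp: halo_action_def intro!: lprod_closed rprod_closed)
  have c1: "?c \<xi> y = y" if "y \<in> carrier D" for y
    using G.inv_one that H by (simp add: halo_action_def left_group_def)
  have inv: "?c g (?c (inv\<^bsub>left_group D \<xi>\<^esub> g) y) = y" "?c (inv\<^bsub>left_group D \<xi>\<^esub> g) (?c g y) = y"
    if "g \<in> carrier (left_group D \<xi>)" "y \<in> carrier D" for g y
    using that G.r_inv[OF that(1)] G.l_inv[OF that(1)] halo_action_mult[OF \<xi>] G.inv_closed c1
    by (auto simp: left_group_def)
  have op: "x \<triangleright>\<^bsub>Conj D\<^esub> y = ?c (\<xi> \<stileturn> x) y" if "x \<in> carrier D" "y \<in> carrier D" for x y
    using conj_rack_op_left_group[OF \<xi> that] .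
  have car: "carrier (Conj D) = carrier D" by (simp add: Conj_def)
  show ?thesis
  proof (unfold_locales, unfold car)
    fix x assume x: "x \<in> carrier D"
    have "bij_betw (?c (\<xi> \<stileturn> x)) (carrier D) (carrier D)"
      by (rule bij_betw_byWitness[where f' = "?c (inv\<^bsub>left_group D \<xi>\<^esub> (\<xi> \<stileturn> x))"])
        (use inv[OF mem[OF x]] cc mem[OF x] G.inv_closed in auto)
    then have "bij_betw (left_translation (Conj D) x) (carrier D) (carrier D)"
      by (rule bij_betw_cong[THEN iffD1, rotated]) (simp add: left_translation_def car op x)
    then show "left_translation (Conj D) x \<in> Bij (carrier D)"
      by (simp add: Bij_def left_translation_def car)
  next
    fix x y z assume x: "x \<in> carrier D" and y: "y \<in> carrier D" and z: "z \<in> carrier D"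
    define g h where "g = \<xi> \<stileturn> x" and "h = \<xi> \<stileturn> y"
    have g: "g \<in> carrier (left_group D \<xi>)" and h: "h \<in> carrier (left_group D \<xi>)"
      unfolding g_def h_def using mem x y by auto
    define g' where "g' = inv\<^bsub>left_group D \<xi>\<^esub> g"
    have g': "g' \<in> carrier (left_group D \<xi>)" "g' \<stileturn> g = \<xi>"
      unfolding g'_def using G.inv_closed[OF g] G.l_inv[OF g] by (auto simp: left_group_def)
    have "\<xi> \<stileturn> ?c g y = \<xi> \<stileturn> ((g \<stileturn> y) \<stileturn> g')"
      using lprod_assoc lprod_bar H(1) Gc(1)[OF g] Gc(1)[OF g'(1)] y
      by (metis g'_def halo_action_def lprod_closed rprod_closed)
    also have "\<dots> = (g \<stileturn> h) \<stileturn> g'"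
      unfolding h_def
      using lprod_assoc H(1) Gc[OF g] Gc(1)[OF g'(1)] y lprod_closed lprod_halo_mid[OF \<xi>]
      by metis
    finally have k: "\<xi> \<stileturn> ?c g y = (g \<stileturn> h) \<stileturn> g'" .
    have kG: "(g \<stileturn> h) \<stileturn> g' \<in> carrier (left_group D \<xi>)"
      using k mem[OF cc[OF g y]] by simp
    have "((g \<stileturn> h) \<stileturn> g') \<stileturn> g = g \<stileturn> h"
      using lprod_assoc g' Gc(1) g h H lprod_closed by simp
    then have "?c ((g \<stileturn> h) \<stileturn> g') (?c g z) = ?c g (?c h z)"
      using halo_action_mult[OF \<xi>] kG g h z by simp
    then show "x \<triangleright>\<^bsub>Conj D\<^esub> (y \<triangleright>\<^bsub>Conj D\<^esub> z) = (x \<triangleright>\<^bsub>Conj D\<^esub> y) \<triangleright>\<^bsub>Conj D\<^esub> (x \<triangleright>\<^bsub>Conj D\<^esub> z)"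
      using op x y z cc g h k by (simp add: g_def h_def)
  qed
qed

end

end

(* Left translation by x depends only on its component \<xi> \<stileturn> x in G, and x \<mapsto> L_x is an action of G
   on D with image Inn (Conj D); so the orbits in question are those of G. In the coordinates
   G \<times> E this action is (h, \<alpha>) \<mapsto> (g h g^-1, g \<bullet> \<alpha>), whose fixed points under g form
   C_G(g) \<times> Fix_E(g), and Burnside's lemma counts the orbits. *)

theory Submission
  imports Defs
begin

text \<open>Orbits see only the set of maps that act, not the group that indexes them. This allows a
  group of permutations to be replaced by any group acting through it, faithfully or not.\<close>

lemma orbits_eq_if_action_image_eq:
  assumes "\<phi> ` carrier G = carrier H"
  shows "orbits H E (\<lambda>f x. f x) = orbits G E \<phi>"
  unfolding orbits_def orbit_def assms[symmetric] by blast

context generalized_digroup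
begin

lemma left_groupD:
  assumes "\<xi> \<in> Halo D" "g \<in> carrier (left_group D \<xi>)"
  shows "g \<in> carrier D" "\<xi> \<stileturn> g = g"
  using assms HaloD[OF assms(1)] lprod_closed lprod_halo_mid[OF assms(1)]
  by (auto simp: left_group_def)

lemma left_group_inverse:
  assumes "\<xi> \<in> Halo D" "g \<in> carrier (left_group D \<xi>)"
  shows "inv\<^bsub>left_group D \<xi>\<^esub> g \<in> carrier (left_group D \<xi>)" "inv\<^bsub>left_group D \<xi>\<^esub> g \<in> carrier D"
    "g \<stileturn> inv\<^bsub>left_group D \<xi>\<^esub> g = \<xi>" "inv\<^bsub>left_group D \<xi>\<^esub> g \<stileturn> g = \<xi>"
proof -
  interpret G: group "left_group D \<xi>" by (rule group_left_group[OF assms(1)])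
  show c: "inv\<^bsub>left_group D \<xi>\<^esub> g \<in> carrier (left_group D \<xi>)" using G.inv_closed[OF assms(2)] .
  show "inv\<^bsub>left_group D \<xi>\<^esub> g \<in> carrier D" by (rule left_groupD[OF assms(1) c])
  show "g \<stileturn> inv\<^bsub>left_group D \<xi>\<^esub> g = \<xi>" "inv\<^bsub>left_group D \<xi>\<^esub> g \<stileturn> g = \<xi>"
    using G.r_inv[OF assms(2)] G.l_inv[OF assms(2)] by (simp_all add: left_group_def)
qed

lemma halo_action_closed:
  assumes "\<xi> \<in> Halo D" "g \<in> carrier (left_group D \<xi>)" "y \<in> carrier D"
  shows "halo_action D \<xi> g y \<in> carrier D"
  unfolding halo_action_def
  using assms left_groupD(1)[OF assms(1,2)] left_group_inverse(2)[OF assms(1,2)]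
  by (intro lprod_closed rprod_closed)

text \<open>The conjugate of a bar-unit acts as a unit on the required side: in either kind of
  product the middle factor \<alpha> is absorbed, and what is left of the conjugation collapses to
  \<open>g \<stileturn> inv g = \<xi>\<close>.\<close>

lemma halo_action_Halo:
  assumes "\<xi> \<in> Halo D" "g \<in> carrier (left_group D \<xi>)" "\<alpha> \<in> Halo D"
  shows "halo_action D \<xi> g \<alpha> \<in> Halo D"
proof -
  note H = HaloD[OF assms(1)] and A = HaloD[OF assms(3)]
  define w where "w = inv\<^bsub>left_group D \<xi>\<^esub> g"
  note g = left_groupD[OF assms(1,2)] and w = left_group_inverse[OF assms(1,2), folded w_def]
  have "a \<stileturn> ((g \<turnstile> \<alpha>) \<stileturn> w) = a" if a: "a \<in> carrier D" for a
  proof -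
    \<comment> \<open>To the right of \<stileturn> the two products are interchangeable, which puts
      \<alpha> where it is a right unit for \<stileturn>.\<close>
    have "a \<stileturn> ((g \<turnstile> \<alpha>) \<stileturn> w) = (a \<stileturn> (g \<stileturn> \<alpha>)) \<stileturn> w"
      using a g A(1) w(2) lprod_assoc[of a "g \<turnstile> \<alpha>" w] lprod_bar[of a g \<alpha>]
      by (simp add: rprod_closed)
    also have "\<dots> = a \<stileturn> (g \<stileturn> w)" using a g A w by (simp add: lprod_assoc)
    finally show ?thesis using a w H by simp
  qed
  moreover have "((g \<turnstile> \<alpha>) \<stileturn> w) \<turnstile> a = a" if a: "a \<in> carrier D" for a
  proof -
    \<comment> \<open>Dually, to the left of \<turnstile> every product may be read as \<turnstile>,
      for which \<alpha> is a left unit.\<close>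
    have "((g \<turnstile> \<alpha>) \<stileturn> w) \<turnstile> a = g \<turnstile> (\<alpha> \<turnstile> (w \<turnstile> a))"
      using a g A(1) w by (simp add: rprod_bar[symmetric] rprod_assoc rprod_closed)
    also have "\<dots> = (g \<stileturn> w) \<turnstile> a"
      using a g A w(2) rprod_bar[of g w a] rprod_assoc[of g w a] by (simp add: rprod_closed)
    finally show ?thesis using a w H by simp
  qed
  ultimately show ?thesis
    using halo_action_closed[OF assms(1,2) A(1)]
    unfolding Halo_def halo_action_def w_def[symmetric] by simp
qed

text \<open>Gives the inverse of the structure isomorphism explicitly. Multiplying by \<xi> on the
  left absorbs \<alpha> and leaves the group part h; cancelling h on the right leaves
  \<open>\<alpha> \<stileturn> \<xi> = \<alpha>\<close>.\<close>

lemma structure_iso_lprod: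
  assumes "\<xi> \<in> Halo D" "h \<in> carrier (left_group D \<xi>)" "\<alpha> \<in> Halo D"
  shows "structure_iso D \<xi> (\<alpha> \<stileturn> h) = (h, \<alpha>)"
proof -
  note H = HaloD[OF assms(1)] and A = HaloD[OF assms(3)]
  note h = left_groupD[OF assms(1,2)] and w = left_group_inverse[OF assms(1,2)]
  have 1: "\<xi> \<stileturn> (\<alpha> \<stileturn> h) = h"
    using lprod_halo_mid[OF assms(3) H(1) h(1)] h(2) by simp
  have "left_inverse D \<xi> (\<alpha> \<stileturn> h) = inv\<^bsub>left_group D \<xi>\<^esub> h"
    using left_inverse_unique(2)[OF assms(1) lprod_closed[OF A(1) h(1)]] 1 by simp
  then show ?thesis
    using 1 A(1) h(1) w H by (simp add: structure_iso_def lprod_assoc)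
qed

text \<open>A right inverse of a bijection is its two-sided inverse: after applying the injective
  \<open>structure_iso\<close>, the remaining identity on \<open>carrier D\<close> follows from the
  one on pairs.\<close>

lemma bij_betw_lprod:
  assumes "\<xi> \<in> Halo D"
  shows "bij_betw (\<lambda>(h, \<alpha>). \<alpha> \<stileturn> h) (carrier (left_group D \<xi>) \<times> Halo D) (carrier D)"
proof (rule bij_betw_byWitness[where f' = "structure_iso D \<xi>"])
  note S = bij_betw_structure_iso[OF assms]
  show "(\<lambda>(h, \<alpha>). \<alpha> \<stileturn> h) ` (carrier (left_group D \<xi>) \<times> Halo D) \<subseteq> carrier D"
    using left_groupD(1)[OF assms] HaloD(1) lprod_closed by auto
  moreover have "structure_iso D \<xi> (case structure_iso D \<xi> x of (h, \<alpha>) \<Rightarrow> \<alpha> \<stileturn> h) = structure_iso D \<xi> x"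
    "structure_iso D \<xi> x \<in> carrier (left_group D \<xi>) \<times> Halo D" if "x \<in> carrier D" for x
    using bij_betwE[OF S] structure_iso_lprod[OF assms] that by (fastforce split: prod.split)+
  ultimately show "\<forall>x \<in> carrier D. (\<lambda>(h, \<alpha>). \<alpha> \<stileturn> h) (structure_iso D \<xi> x) = x"
    by (intro ballI inj_onD[OF bij_betw_imp_inj_on[OF S]]) blast+
  show "structure_iso D \<xi> ` carrier D \<subseteq> carrier (left_group D \<xi>) \<times> Halo D"
    using S by (simp add: bij_betw_def)
qed (use structure_iso_lprod[OF assms] in auto)

text \<open>Computes the action in coordinates: the pair (h, \<alpha>) goes to (g h g^-1, g
  \<bullet> \<alpha>). The inner factors \<open>inv g\<close> and g cancel to \<xi>, which vanishes
  between two \<stileturn>-factors.\<close>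

lemma halo_action_lprod:
  assumes "\<xi> \<in> Halo D" "g \<in> carrier (left_group D \<xi>)" "h \<in> carrier (left_group D \<xi>)" "\<alpha> \<in> Halo D"
  shows "halo_action D \<xi> g (\<alpha> \<stileturn> h)
       = halo_action D \<xi> g \<alpha> \<stileturn> ((g \<stileturn> h) \<stileturn> inv\<^bsub>left_group D \<xi>\<^esub> g)"
proof -
  note A = HaloD(1)[OF assms(4)]
  define w where "w = inv\<^bsub>left_group D \<xi>\<^esub> g"
  note g = left_groupD[OF assms(1,2)] and h = left_groupD[OF assms(1,3)]
    and w = left_group_inverse[OF assms(1,2), folded w_def]
  have "((g \<turnstile> \<alpha>) \<stileturn> w) \<stileturn> ((g \<stileturn> h) \<stileturn> w) = (g \<turnstile> \<alpha>) \<stileturn> ((w \<stileturn> g) \<stileturn> (h \<stileturn> w))"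
    using A g h w(2) by (simp add: lprod_assoc lprod_closed rprod_closed)
  also have "\<dots> = (g \<turnstile> \<alpha>) \<stileturn> (h \<stileturn> w)"
    using A g h w assms(1) by (simp add: lprod_halo_mid lprod_closed rprod_closed lprod_assoc[symmetric])
  also have "\<dots> = (g \<turnstile> (\<alpha> \<stileturn> h)) \<stileturn> w"
    using A g h w(2) by (simp add: inner_assoc lprod_assoc rprod_closed)
  finally show ?thesis unfolding halo_action_def w_def[symmetric] by simp
qed

lemma left_translation_Conj:
  assumes "\<xi> \<in> Halo D" "x \<in> carrier D"
  shows "left_translation (Conj D) x = restrict (halo_action D \<xi> (\<xi> \<stileturn> x)) (carrier D)"
  using conj_rack_op_left_group[OF assms] by (auto simp: left_translation_def Conj_def)

lemma left_translation_Conj_left_group: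
  assumes "\<xi> \<in> Halo D" "g \<in> carrier (left_group D \<xi>)"
  shows "left_translation (Conj D) g = restrict (halo_action D \<xi> g) (carrier D)"
  using left_translation_Conj[OF assms(1)] left_groupD[OF assms] by simp

text \<open>Both x and its component \<open>\<xi> \<stileturn> x\<close> induce the same
  translation, so the elements of the left group already yield all generators of the inner
  group.\<close>

lemma left_translation_image_left_group:
  assumes "\<xi> \<in> Halo D"
  shows "left_translation (Conj D) ` carrier (left_group D \<xi>)
       = left_translation (Conj D) ` carrier D"
proof -
  have c: "\<xi> \<stileturn> x \<in> carrier (left_group D \<xi>)" if "x \<in> carrier D" for x
    using that by (auto simp: left_group_def)
  have "left_translation (Conj D) x = left_translation (Conj D) (\<xi> \<stileturn> x)" if "x \<in> carrier D" for x
    using left_translation_Conj[OF assms that] left_translation_Conj_left_group[OF assms c[OF that]]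
    by simp
  then show ?thesis using c left_groupD(1)[OF assms] by blast
qed

text \<open>Multiplicativity comes from \<open>halo_action_mult\<close>, which holds on all of D and
  not only on the halo; bijectivity of each translation is the rack property.\<close>

lemma group_hom_left_translation:
  assumes "\<xi> \<in> Halo D"
  shows "group_hom (left_group D \<xi>) (BijGroup (carrier D)) (left_translation (Conj D))"
proof (intro group_hom.intro group_hom_axioms.intro homI)
  interpret rack "Conj D" by (rule rack_Conj)
  interpret G: group "left_group D \<xi>" by (rule group_left_group[OF assms])
  let ?G = "left_group D \<xi>" and ?L = "left_translation (Conj D)"
  have B: "?L g \<in> Bij (carrier D)" if "g \<in> carrier ?G" for g
    using left_translation_bij left_groupD(1)[OF assms that] by (simp add: Conj_def)
  show "?L g \<in> carrier (BijGroup (carrier D))" if "g \<in> carrier ?G" for g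
    using B[OF that] by (simp add: BijGroup_def)
  fix g h assume g: "g \<in> carrier ?G" and h: "h \<in> carrier ?G"
  have gh: "g \<stileturn> h \<in> carrier ?G" using G.m_closed[OF g h] by (simp add: left_group_def)
  \<comment> \<open>The restrictions to \<open>carrier D\<close> do no harm because the action maps
    \<open>carrier D\<close> into itself.\<close>
  have "?L (g \<stileturn> h) = compose (carrier D) (?L g) (?L h)"
    using g h gh halo_action_mult[OF assms g h] halo_action_closed[OF assms h]
    by (auto simp: compose_def left_translation_Conj_left_group[OF assms])
  then show "?L (g \<otimes>\<^bsub>?G\<^esub> h) = ?L g \<otimes>\<^bsub>BijGroup (carrier D)\<^esub> ?L h"
    using B[OF g] B[OF h] by (simp add: BijGroup_def left_group_def)
qed (simp_all add: group_left_group assms group_BijGroup)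

text \<open>The generating set is the image of a group homomorphism, hence already a subgroup, and
  generating adds nothing to it.\<close>

lemma carrier_Inn_Conj:
  assumes "\<xi> \<in> Halo D"
  shows "left_translation (Conj D) ` carrier (left_group D \<xi>) = carrier (Inn (Conj D))"
proof -
  interpret group_hom "left_group D \<xi>" "BijGroup (carrier D)" "left_translation (Conj D)"
    by (rule group_hom_left_translation[OF assms])
  show ?thesis
    using subgroup.carrier_subgroup_generated_subgroup[OF img_is_subgroup]
    by (simp add: Inn_def Conj_def left_translation_image_left_group[OF assms, unfolded Conj_def])
qed

text \<open>The structure isomorphism is equivariant for the transported action, so it carries
  orbits bijectively to orbits.\<close>

lemma card_orbits_transported:
  assumes "\<xi> \<in> Halo D"
  shows "card (orbits (Inn (Conj D)) (carrier (left_group D \<xi>) \<times> Halo D) (transported_action D \<xi>))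
       = card (orbits (Inn (Conj D)) (carrier D) (\<lambda>f x. f x))"
proof -
  let ?S = "structure_iso D \<xi>" and ?I = "Inn (Conj D)"
  let ?P = "carrier (left_group D \<xi>) \<times> Halo D"
  note S = bij_betw_structure_iso[OF assms]
  interpret group_action "left_group D \<xi>" "carrier D" "left_translation (Conj D)"
    by (rule group_action.intro[OF group_hom_left_translation[OF assms]])
  have orb: "orbit ?I (transported_action D \<xi>) (?S x) = ?S ` orbit ?I (\<lambda>f x. f x) x"
    if "x \<in> carrier D" for x
    using inv_into_f_f[OF bij_betw_imp_inj_on[OF S] that]
    by (auto simp: orbit_def transported_action_def)
  have "orbits ?I ?P (transported_action D \<xi>)
      = {orbit ?I (transported_action D \<xi>) (?S x) | x. x \<in> carrier D}"
    unfolding orbits_def bij_betw_imp_surj_on[OF S, symmetric] by blast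
  also have "\<dots> = (`) ?S ` orbits ?I (carrier D) (\<lambda>f x. f x)"
    unfolding orbits_def using orb by blast
  finally have eq: "orbits ?I ?P (transported_action D \<xi>)
      = (`) ?S ` orbits ?I (carrier D) (\<lambda>f x. f x)" .
  \<comment> \<open>Distinct orbits have distinct images because all of them lie in
    \<open>carrier D\<close>, where \<open>structure_iso\<close> is injective.\<close>
  have "\<Union> (orbits ?I (carrier D) (\<lambda>f x. f x)) = carrier D"
    using orbits_eq_if_action_image_eq[OF carrier_Inn_Conj[OF assms]] orbits_coverture by simp
  then have "inj_on ((`) ?S) (orbits ?I (carrier D) (\<lambda>f x. f x))"
    using bij_betw_imp_inj_on[OF S] by (intro inj_on_image) simp
  then show ?thesis unfolding eq by (rule card_image)
qed

text \<open>Coordinates are unique, so \<open>\<alpha> \<stileturn> h\<close> is fixed exactly when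
  g h g^-1 = h and g \<bullet> \<alpha> = \<alpha>. The two conditions are independent, hence the
  product of cardinalities.\<close>

lemma card_invariants_left_translation:
  assumes "\<xi> \<in> Halo D" "g \<in> carrier (left_group D \<xi>)"
  shows "card (invariants (carrier D) (left_translation (Conj D)) g)
       = card (elem_centralizer (left_group D \<xi>) g) * card (invariants (Halo D) (halo_action D \<xi>) g)"
proof -
  interpret G: group "left_group D \<xi>" by (rule group_left_group[OF assms(1)])
  let ?G = "left_group D \<xi>" and ?j = "\<lambda>(h, \<alpha>). \<alpha> \<stileturn> h"
  let ?C = "elem_centralizer ?G g" and ?F = "invariants (Halo D) (halo_action D \<xi>) g"
  note j = bij_betw_lprod[OF assms(1)]
  have fixed: "left_translation (Conj D) g (?j p) = ?j p \<longleftrightarrow> p \<in> ?C \<times> ?F"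
    if p_mem: "p \<in> carrier ?G \<times> Halo D" for p
  proof -
    obtain h \<alpha> where p: "p = (h, \<alpha>)" and h: "h \<in> carrier ?G" and \<alpha>: "\<alpha> \<in> Halo D"
      using p_mem by auto
    let ?k = "g \<otimes>\<^bsub>?G\<^esub> h \<otimes>\<^bsub>?G\<^esub> inv\<^bsub>?G\<^esub> g"
    have k: "?k \<in> carrier ?G" using assms(2) h by simp
    have c: "?j (h, \<alpha>) \<in> carrier D" using bij_betwE[OF j] h \<alpha> by blast
    have "left_translation (Conj D) g (?j p) = ?j (?k, halo_action D \<xi> g \<alpha>)"
      using c halo_action_lprod[OF assms h \<alpha>]
      by (simp add: p left_translation_Conj_left_group[OF assms] left_group_def)
    also have "\<dots> = ?j p \<longleftrightarrow> (?k, halo_action D \<xi> g \<alpha>) = (h, \<alpha>)"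
      unfolding p using k halo_action_Halo[OF assms \<alpha>] h \<alpha>
      by (intro inj_on_eq_iff[OF bij_betw_imp_inj_on[OF j]]) auto
    also have "\<dots> \<longleftrightarrow> p \<in> ?C \<times> ?F"
      \<comment> \<open>Moving the inverse across turns g h g^-1 = h into g h = h g, the condition
        defining the centralizer.\<close>
      using G.inv_solve_right'[of h "g \<otimes>\<^bsub>?G\<^esub> h" g] assms(2) h \<alpha>
      by (simp add: p elem_centralizer_def invariants_def)
    finally show ?thesis .
  qed
  have CF: "?C \<times> ?F \<subseteq> carrier ?G \<times> Halo D"
    by (auto simp: elem_centralizer_def invariants_def)
  have "{p \<in> carrier ?G \<times> Halo D. left_translation (Conj D) g (?j p) = ?j p} = ?C \<times> ?F"
    (is "?Q = _")
  proof (rule Set.set_eqI)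
    show "p \<in> ?Q \<longleftrightarrow> p \<in> ?C \<times> ?F" for p
      using fixed[of p] subsetD[OF CF, of p] unfolding mem_Collect_eq by argo
  qed
  moreover have "invariants (carrier D) (left_translation (Conj D)) g
      = ?j ` {p \<in> carrier ?G \<times> Halo D. left_translation (Conj D) g (?j p) = ?j p}"
    unfolding invariants_def bij_betw_imp_surj_on[OF j, symmetric]
    by (rule Compr_image_eq)
  ultimately have "invariants (carrier D) (left_translation (Conj D)) g = ?j ` (?C \<times> ?F)"
    by (simp only:)
  then show ?thesis
    using card_image[OF inj_on_subset[OF bij_betw_imp_inj_on[OF j] CF]]
    by (simp add: card_cartesian_product)
qed

end

theorem corollary4p5:
  fixes D :: "('a, 'b) digroup_scheme" and \<xi> :: 'a
  assumes "generalized_digroup D"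
    and "finite (carrier D)"
    and "\<xi> \<in> Halo D"
  shows "card (orbits (Inn (Conj D)) (carrier (Conj D)) (\<lambda>f x. f x)) =
         card (orbits (Inn (Conj D)) (carrier (left_group D \<xi>) \<times> Halo D) (transported_action D \<xi>))
       \<and> real (card (orbits (Inn (Conj D)) (carrier (left_group D \<xi>) \<times> Halo D)
                        (transported_action D \<xi>))) =
           1 / real (card (carrier (left_group D \<xi>))) *
           (\<Sum>g \<in> carrier (left_group D \<xi>).
              real (card (elem_centralizer (left_group D \<xi>) g)) *
              real (card (invariants (Halo D) (halo_action D \<xi>) g)))"
proof -
  interpret generalized_digroup D by (rule assms(1))
  let ?G = "left_group D \<xi>"
  let ?N = "card (orbits (Inn (Conj D)) (carrier ?G \<times> Halo D) (transported_action D \<xi>))"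
  interpret group_action ?G "carrier D" "left_translation (Conj D)"
    by (rule group_action.intro[OF group_hom_left_translation[OF assms(3)]])
  have fin: "finite (carrier ?G)"
    using left_groupD(1)[OF assms(3)] by (intro finite_subset[OF _ assms(2)]) auto
  have ne: "card (carrier ?G) \<noteq> 0"
    using fin monoid.one_closed[OF group.is_monoid[OF group_left_group[OF assms(3)]]] by auto
  \<comment> \<open>Burnside's lemma is applied to the left group instead of the inner group.
    Elements acting by the same permutation are then counted separately in the sum, in agreement
    with the division by |G|.\<close>
  have orbits: "orbits (Inn (Conj D)) (carrier D) (\<lambda>f x. f x)
      = orbits ?G (carrier D) (left_translation (Conj D))"
    by (rule orbits_eq_if_action_image_eq[OF carrier_Inn_Conj[OF assms(3)]])
  have "?N * card (carrier ?G) = (\<Sum>g \<in> carrier ?G.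
      card (elem_centralizer ?G g) * card (invariants (Halo D) (halo_action D \<xi>) g))"
    using burnside[OF fin assms(2)] card_invariants_left_translation[OF assms(3)]
    by (simp add: card_orbits_transported[OF assms(3)] orbits order_def)
  then have "real ?N * real (card (carrier ?G)) = (\<Sum>g \<in> carrier ?G.
      real (card (elem_centralizer ?G g)) * real (card (invariants (Halo D) (halo_action D \<xi>) g)))"
    by (simp flip: of_nat_mult of_nat_sum)
  then show ?thesis
    using ne card_orbits_transported[OF assms(3)] by (simp add: Conj_def field_simps)
qed

end
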